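(* Let $S=\{s_1,s_2,s_3,\ldots\}$ be a countably infinite enumerated set (the $s_i$ pairwise distinct) and let $m$ be a Coxeter matrix over $S$ with $m(s,s')\geq 4$ for all $s,s'\in S$ with $s\neq s'$ (the value $\infty$ being allowed). Let $A$ be the corresponding Artin group (of extra large type) with generators $a_i=a_{s_i}$, $i\in\mathbb{N}$, and let $\varphi_A$ be the canonical trace on $\mathbb{C}A$. Then for all $k\in\mathbb{N}$ \[ \lim_{N\rightarrow\infty}\varphi_A\left(\left(\frac{\delta(a_1)+\delta(a_1^{-1})+\ldots+\delta(a_N)+\delta(a_N^{-1})}{\sqrt{2N}}\right)^k\right)=\begin{cases}0 & \text{if } k \text{ is odd},\\[4pt] \dfrac{1}{n+1}\dbinom{2n}{n} & \text{if } k=2n \text{ is even}.\end{cases} \]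
   Context: A Coxeter matrix over $S$ is a symmetric function $m:S\times S\to\mathbb{N}\cup\{\infty\}$ with $m(s,s)=1$ and $m(s,s')\geq 2$ for $s\neq s'$. The Artin group $A$ corresponding to $m$ is the group with generating set $\{a_s:s\in S\}$ and defining relations, for $s\neq s'$ in $S$ with $m(s,s')<\infty$, $a_sa_{s'}a_s\cdots=a_{s'}a_sa_{s'}\cdots$, where both products have $m(s,s')$ factors (for infinite $S$ it is the inductive limit of the Artin groups of the restrictions of $m$ to finite subsets of $S$). The group algebra $\mathbb{C}A$ consists of finite formal sums $\sum_{x\in A}c_x\delta(x)$ with convolution product determined by $\delta(x)\delta(y)=\delta(xy)$, and $\varphi_A\left(\sum_x c_x\delta(x)\right)=c_{\mathrm{Id}}$ is the coefficient at the identity. *)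

theory Defs
  imports Complex_Main "HOL-Algebra.Module" "HOL-Library.Extended_Nat" "HOL-Library.Poly_Mapping"
begin

text \<open>A letter \<open>(x, True)\<close> stands for the generator \<open>x\<close>, a letter \<open>(x, False)\<close> for its formal
  inverse.\<close>

type_synonym 'x word = "('x \<times> bool) list"

definition words :: "'x set \<Rightarrow> 'x word set"
  where "words X = lists (X \<times> UNIV)"

text \<open>The congruence on words over \<open>X\<close> generated by free cancellation and by the relations
  \<open>l = r\<close> for \<open>(l, r) \<in> R\<close>.\<close>

inductive pres_eq :: "'x set \<Rightarrow> ('x word \<times> 'x word) set \<Rightarrow> 'x word \<Rightarrow> 'x word \<Rightarrow> bool"
  for X :: "'x set" and R :: "('x word \<times> 'x word) set"
  where
    refl: "w \<in> words X \<Longrightarrow> pres_eq X R w w"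
  | sym: "pres_eq X R u v \<Longrightarrow> pres_eq X R v u"
  | trans: "pres_eq X R u v \<Longrightarrow> pres_eq X R v w \<Longrightarrow> pres_eq X R u w"
  | cancel: "x \<in> X \<Longrightarrow> u \<in> words X \<Longrightarrow> v \<in> words X \<Longrightarrow>
      pres_eq X R (u @ [(x, b), (x, \<not> b)] @ v) (u @ v)"
  | relation: "(l, r) \<in> R \<Longrightarrow> l \<in> words X \<Longrightarrow> r \<in> words X \<Longrightarrow> u \<in> words X \<Longrightarrow> v \<in> words X \<Longrightarrow>
      pres_eq X R (u @ l @ v) (u @ r @ v)"

definition pres_class :: "'x set \<Rightarrow> ('x word \<times> 'x word) set \<Rightarrow> 'x word \<Rightarrow> 'x word set"
  where "pres_class X R w = {w'. pres_eq X R w w'}"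

definition presented_group :: "'x set \<Rightarrow> ('x word \<times> 'x word) set \<Rightarrow> 'x word set monoid"
  where "presented_group X R =
    \<lparr>carrier = pres_class X R ` words X,
     mult = (\<lambda>A B. \<Union>u\<in>A. \<Union>v\<in>B. pres_class X R (u @ v)),
     one = pres_class X R []\<rparr>"

definition coxeter_matrix :: "'s set \<Rightarrow> ('s \<Rightarrow> 's \<Rightarrow> enat) \<Rightarrow> bool"
  where "coxeter_matrix S m \<longleftrightarrow>
    (\<forall>s\<in>S. \<forall>t\<in>S. m s t = m t s) \<and>
    (\<forall>s\<in>S. m s s = 1) \<and>
    (\<forall>s\<in>S. \<forall>t\<in>S. s \<noteq> t \<longrightarrow> m s t \<ge> 2)"

text \<open>The word \<open>s t s \<dots>\<close> with \<open>n\<close> letters.\<close>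

definition alternating_word :: "nat \<Rightarrow> 's \<Rightarrow> 's \<Rightarrow> 's word"
  where "alternating_word n s t = map (\<lambda>i. (if even i then s else t, True)) [0..<n]"

definition artin_relations :: "'s set \<Rightarrow> ('s \<Rightarrow> 's \<Rightarrow> enat) \<Rightarrow> ('s word \<times> 's word) set"
  where "artin_relations S m =
    {(alternating_word n s t, alternating_word n t s) | n s t.
      s \<in> S \<and> t \<in> S \<and> s \<noteq> t \<and> m s t = enat n}"

definition artin_group :: "'s set \<Rightarrow> ('s \<Rightarrow> 's \<Rightarrow> enat) \<Rightarrow> 's word set monoid"
  where "artin_group S m = presented_group S (artin_relations S m)"

definition artin_generator :: "'s set \<Rightarrow> ('s \<Rightarrow> 's \<Rightarrow> enat) \<Rightarrow> 's \<Rightarrow> 's word set"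
  where "artin_generator S m s = pres_class S (artin_relations S m) [(s, True)]"

definition group_algebra ::
    "('g, 'b) monoid_scheme \<Rightarrow> (complex, 'g \<Rightarrow>\<^sub>0 complex) module"
  where "group_algebra G =
    \<lparr>carrier = {f. Poly_Mapping.keys f \<subseteq> carrier G},
     mult = (\<lambda>f g. \<Sum>x\<in>Poly_Mapping.keys f. \<Sum>y\<in>Poly_Mapping.keys g.
       Poly_Mapping.single (x \<otimes>\<^bsub>G\<^esub> y) (Poly_Mapping.lookup f x * Poly_Mapping.lookup g y)),
     one = Poly_Mapping.single \<one>\<^bsub>G\<^esub> 1,
     zero = 0,
     add = (+),
     smult = (\<lambda>c. Poly_Mapping.map ((*) c))\<rparr>"

definition delta :: "'g \<Rightarrow> 'g \<Rightarrow>\<^sub>0 complex"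
  where "delta x = Poly_Mapping.single x 1"

definition canonical_trace :: "('g, 'b) monoid_scheme \<Rightarrow> ('g \<Rightarrow>\<^sub>0 complex) \<Rightarrow> complex"
  where "canonical_trace G f = Poly_Mapping.lookup f \<one>\<^bsub>G\<^esub>"

lemma words_simps [simp]:
  "[] \<in> words X" "p # w \<in> words X \<longleftrightarrow> fst p \<in> X \<and> w \<in> words X"
  "u @ v \<in> words X \<longleftrightarrow> u \<in> words X \<and> v \<in> words X"
  by (cases p; auto simp: words_def)+

lemma pres_eq_words: "pres_eq X R u v \<Longrightarrow> u \<in> words X \<and> v \<in> words X"
  by (induction rule: pres_eq.induct) auto

lemma pres_eq_context:
  assumes "pres_eq X R u v" "p \<in> words X" "q \<in> words X"
  shows "pres_eq X R (p @ u @ q) (p @ v @ q)"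
  using assms
proof (induction rule: pres_eq.induct)
  case (refl w)
  then show ?case by (auto intro: pres_eq.refl)
next
  case (sym u v)
  then show ?case by (auto intro: pres_eq.sym)
next
  case (trans u v w)
  then show ?case by (auto intro: pres_eq.trans)
next
  case (cancel x u v b)
  then show ?case using pres_eq.cancel[of x X "p @ u" "v @ q" R b] by simp
next
  case (relation l r u v)
  then show ?case using pres_eq.relation[of l r R X "p @ u" "v @ q"] by simp
qed

lemma pres_eq_append:
  assumes "pres_eq X R u u'" "pres_eq X R v v'"
  shows "pres_eq X R (u @ v) (u' @ v')"
  using pres_eq_context[OF assms(1), of "[]" v] pres_eq_context[OF assms(2), of u' "[]"]
    pres_eq_words[OF assms(1)] pres_eq_words[OF assms(2)]
  by (auto intro: pres_eq.trans)

lemma pres_class_eq_iff: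
  assumes "u \<in> words X"
  shows "pres_class X R u = pres_class X R v \<longleftrightarrow> pres_eq X R u v"
  using assms unfolding pres_class_def
  by (auto intro: pres_eq.intros)

lemma mult_presented_group:
  assumes "u \<in> words X" "v \<in> words X"
  shows "pres_class X R u \<otimes>\<^bsub>presented_group X R\<^esub> pres_class X R v = pres_class X R (u @ v)"
  using assms unfolding presented_group_def pres_class_def
  by (auto intro: pres_eq.refl pres_eq.trans pres_eq_append)

definition inv_word :: "'x word \<Rightarrow> 'x word"
  where "inv_word w = rev (map (\<lambda>(x, b). (x, \<not> b)) w)"

lemma inv_word_in_words: "w \<in> words X \<Longrightarrow> inv_word w \<in> words X"
  by (induction w) (auto simp: inv_word_def)

lemma pres_eq_inv_word: "w \<in> words X \<Longrightarrow> pres_eq X R (inv_word w @ w) []"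
proof (induction w)
  case Nil
  then show ?case by (simp add: inv_word_def pres_eq.refl)
next
  case (Cons p w)
  obtain x b where p: "p = (x, b)" by force
  have "pres_eq X R (inv_word w @ [(x, \<not> b), (x, \<not> \<not> b)] @ w) (inv_word w @ w)"
    using Cons.prems p by (intro pres_eq.cancel) (auto intro: inv_word_in_words)
  then show ?case using Cons p by (auto simp: inv_word_def intro: pres_eq.trans)
qed

lemma group_presented_group: "group (presented_group X R)"
proof (rule groupI)
  fix A assume "A \<in> carrier (presented_group X R)"
  then obtain w where w: "w \<in> words X" "A = pres_class X R w"
    by (auto simp: presented_group_def)
  have *: "\<one>\<^bsub>presented_group X R\<^esub> = pres_class X R []" by (simp add: presented_group_def)
  show "\<one>\<^bsub>presented_group X R\<^esub> \<otimes>\<^bsub>presented_group X R\<^esub> A = A"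
    using w by (simp add: * mult_presented_group)
  have "pres_class X R (inv_word w) \<otimes>\<^bsub>presented_group X R\<^esub> A = \<one>\<^bsub>presented_group X R\<^esub>"
    using w pres_eq_inv_word[of w X R]
    by (simp add: * mult_presented_group inv_word_in_words pres_class_eq_iff)
  moreover have "pres_class X R (inv_word w) \<in> carrier (presented_group X R)"
    using w by (auto simp: presented_group_def inv_word_in_words)
  ultimately show "\<exists>B\<in>carrier (presented_group X R).
      B \<otimes>\<^bsub>presented_group X R\<^esub> A = \<one>\<^bsub>presented_group X R\<^esub>" by blast
next
  fix A B assume "A \<in> carrier (presented_group X R)" "B \<in> carrier (presented_group X R)"
  then obtain u v where "u \<in> words X" "A = pres_class X R u" "v \<in> words X" "B = pres_class X R v"
    by (auto simp: presented_group_def)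
  then show "A \<otimes>\<^bsub>presented_group X R\<^esub> B \<in> carrier (presented_group X R)"
    by (simp add: mult_presented_group) (simp add: presented_group_def)
next
  fix A B C assume "A \<in> carrier (presented_group X R)" "B \<in> carrier (presented_group X R)"
    "C \<in> carrier (presented_group X R)"
  then obtain u v w where "u \<in> words X" "A = pres_class X R u" "v \<in> words X" "B = pres_class X R v"
    "w \<in> words X" "C = pres_class X R w"
    by (auto simp: presented_group_def)
  then show "A \<otimes>\<^bsub>presented_group X R\<^esub> B \<otimes>\<^bsub>presented_group X R\<^esub> C =
      A \<otimes>\<^bsub>presented_group X R\<^esub> (B \<otimes>\<^bsub>presented_group X R\<^esub> C)"
    by (simp add: mult_presented_group)
qed (auto simp: presented_group_def)

lemma group_artin_group: "group (artin_group S m)"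
  unfolding artin_group_def by (rule group_presented_group)

lemma artin_generator_in_carrier: "s \<in> S \<Longrightarrow> artin_generator S m s \<in> carrier (artin_group S m)"
  by (auto simp: artin_generator_def artin_group_def presented_group_def)

text \<open>For infinite \<open>S\<close>, the presentation over \<open>S\<close> gives the inductive limit of the Artin groups
  over the finite subsets of \<open>S\<close>: every word lies over some finite subset, and two words are
  equal in the group over \<open>S\<close> iff they already are in the group over some finite subset.\<close>

lemma artin_relations_mono: "F \<subseteq> S \<Longrightarrow> artin_relations F m \<subseteq> artin_relations S m"
  unfolding artin_relations_def by blast

lemma words_mono: "F \<subseteq> S \<Longrightarrow> words F \<subseteq> words S"
  unfolding words_def by (intro lists_mono) auto

lemma pres_eq_artin_mono:
  assumes "pres_eq F (artin_relations F m) u v" "F \<subseteq> S"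
  shows "pres_eq S (artin_relations S m) u v"
  using assms
proof (induction rule: pres_eq.induct)
  case (relation l r u v)
  then show ?case
    using words_mono[OF \<open>F \<subseteq> S\<close>] artin_relations_mono[OF \<open>F \<subseteq> S\<close>, of m]
    by (intro pres_eq.relation) blast+
next
  case (trans u v w)
  then show ?case by (blast intro: pres_eq.trans)
qed (use words_mono[of F S] in \<open>blast intro: pres_eq.intros\<close>)+

lemma words_finite_subset:
  assumes "w \<in> words S"
  shows "\<exists>F. finite F \<and> F \<subseteq> S \<and> w \<in> words F"
  using assms
  by (intro exI[of _ "fst ` set w"]) (force simp: words_def)

lemma pres_eq_artin_finite_subset:
  "pres_eq S (artin_relations S m) u v \<longleftrightarrow>
    (\<exists>F. finite F \<and> F \<subseteq> S \<and> pres_eq F (artin_relations F m) u v)"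
proof
  assume "pres_eq S (artin_relations S m) u v"
  then show "\<exists>F. finite F \<and> F \<subseteq> S \<and> pres_eq F (artin_relations F m) u v"
  proof (induction rule: pres_eq.induct)
    case (refl w)
    then show ?case using words_finite_subset[of w S] by (blast intro: pres_eq.refl)
  next
    case (sym u v)
    then show ?case by (blast intro: pres_eq.sym)
  next
    case (trans u v w)
    then obtain F F' where "finite F" "F \<subseteq> S" "pres_eq F (artin_relations F m) u v"
      "finite F'" "F' \<subseteq> S" "pres_eq F' (artin_relations F' m) v w" by blast
    then show ?case
      using pres_eq_artin_mono[of F m u v "F \<union> F'"] pres_eq_artin_mono[of F' m v w "F \<union> F'"]
      by (intro exI[of _ "F \<union> F'"]) (auto intro: pres_eq.trans)
  next
    case (cancel x u v b)
    then obtain F where F: "finite F" "F \<subseteq> S" "u @ v \<in> words F"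
      using words_finite_subset[of "u @ v" S] by auto
    then have "u \<in> words (insert x F)" "v \<in> words (insert x F)"
      using words_mono[of F "insert x F"] by auto
    then show ?case using F cancel.hyps
      by (intro exI[of _ "insert x F"] conjI pres_eq.cancel) auto
  next
    case (relation l r u v)
    from relation.hyps obtain n s t where st: "s \<in> S" "t \<in> S" "s \<noteq> t" "m s t = enat n"
      "l = alternating_word n s t" "r = alternating_word n t s"
      by (auto simp: artin_relations_def)
    obtain F where F: "finite F" "F \<subseteq> S" "u @ v \<in> words F"
      using words_finite_subset[of "u @ v" S] relation.hyps by auto
    define F' where "F' = insert s (insert t F)"
    have "u \<in> words F'" "v \<in> words F'"
      using F words_mono[of F F'] by (auto simp: F'_def)
    moreover have "(l, r) \<in> artin_relations F' m"
      using st by (auto simp: artin_relations_def F'_def)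
    moreover have "l \<in> words F'" "r \<in> words F'"
      using st by (auto simp: words_def alternating_word_def F'_def split: if_splits)
    ultimately show ?case using F st
      by (intro exI[of _ F'] conjI pres_eq.relation) (auto simp: F'_def)
  qed
qed (auto intro: pres_eq_artin_mono)

lemma group_algebra_simps [simp]:
  "carrier (group_algebra G) = {f. Poly_Mapping.keys f \<subseteq> carrier G}"
  "zero (group_algebra G) = 0"
  "add (group_algebra G) = (+)"
  "one (group_algebra G) = delta \<one>\<^bsub>G\<^esub>"
  by (simp_all add: group_algebra_def delta_def)

lemma lookup_smult_group_algebra:
  "Poly_Mapping.lookup (c \<odot>\<^bsub>group_algebra G\<^esub> f) x = c * Poly_Mapping.lookup f x"
  by (simp add: group_algebra_def Poly_Mapping.map.rep_eq when_def)

lemma delta_mult_delta: "delta x \<otimes>\<^bsub>group_algebra G\<^esub> delta y = delta (x \<otimes>\<^bsub>G\<^esub> y)"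
  by (simp add: group_algebra_def delta_def)

lemma group_algebra_add_mult:
  "(f + g) \<otimes>\<^bsub>group_algebra G\<^esub> h = f \<otimes>\<^bsub>group_algebra G\<^esub> h + g \<otimes>\<^bsub>group_algebra G\<^esub> h"
  unfolding group_algebra_def
  by (simp, subst setsum_keys_plus_distrib)
     (auto simp: single_add sum.distrib distrib_right)

lemma group_algebra_mult_add:
  "h \<otimes>\<^bsub>group_algebra G\<^esub> (f + g) = h \<otimes>\<^bsub>group_algebra G\<^esub> f + h \<otimes>\<^bsub>group_algebra G\<^esub> g"
  unfolding group_algebra_def
  by (simp add: sum.distrib[symmetric], rule sum.cong, simp, subst setsum_keys_plus_distrib)
     (auto simp: single_add distrib_left)

lemma group_algebra_mult_zero [simp]:
  "0 \<otimes>\<^bsub>group_algebra G\<^esub> h = 0" "h \<otimes>\<^bsub>group_algebra G\<^esub> 0 = 0"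
  by (simp_all add: group_algebra_def)

lemma single_mult_single_group_algebra:
  "Poly_Mapping.single x c \<otimes>\<^bsub>group_algebra G\<^esub> Poly_Mapping.single y d =
    Poly_Mapping.single (x \<otimes>\<^bsub>G\<^esub> y) (c * d)"
  by (simp add: group_algebra_def)

lemma group_algebra_induct [consumes 1, case_names zero single add]:
  fixes f :: "'g \<Rightarrow>\<^sub>0 complex"
  assumes "Poly_Mapping.keys f \<subseteq> A"
    and zero: "P 0"
    and single: "\<And>x c. x \<in> A \<Longrightarrow> P (Poly_Mapping.single x c)"
    and add: "\<And>f g. P f \<Longrightarrow> P g \<Longrightarrow> P (f + g)"
  shows "P f"
proof -
  have eq: "f = (\<Sum>x\<in>Poly_Mapping.keys f. Poly_Mapping.single x (Poly_Mapping.lookup f x))"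
    by (rule poly_mapping_eqI)
       (auto simp: lookup_sum lookup_single when_def in_keys_iff sum.delta)
  have "P (\<Sum>x\<in>K. Poly_Mapping.single x (Poly_Mapping.lookup f x))" if "finite K" "K \<subseteq> A" for K
    using that by (induction rule: finite_induct) (auto intro: zero single add)
  from this[of "Poly_Mapping.keys f"] show ?thesis using eq assms(1) by simp
qed

lemma ring_group_algebra:
  assumes "group G"
  shows "ring (group_algebra G)"
proof -
  interpret G: group G by fact
  have closed: "Poly_Mapping.keys (f \<otimes>\<^bsub>group_algebra G\<^esub> g) \<subseteq> carrier G"
    if "Poly_Mapping.keys f \<subseteq> carrier G" "Poly_Mapping.keys g \<subseteq> carrier G" for f g
  proof -
    have "Poly_Mapping.keys (f \<otimes>\<^bsub>group_algebra G\<^esub> g) \<subseteq>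
        (\<Union>x\<in>Poly_Mapping.keys f. \<Union>y\<in>Poly_Mapping.keys g. {x \<otimes>\<^bsub>G\<^esub> y})"
      unfolding group_algebra_def
      by (simp, rule order_trans[OF keys_sum], rule UN_mono, simp,
          rule order_trans[OF keys_sum], rule UN_mono) auto
    then show ?thesis using that by blast
  qed
  have assoc: "f \<otimes>\<^bsub>group_algebra G\<^esub> g \<otimes>\<^bsub>group_algebra G\<^esub> h =
      f \<otimes>\<^bsub>group_algebra G\<^esub> (g \<otimes>\<^bsub>group_algebra G\<^esub> h)"
    if f: "Poly_Mapping.keys f \<subseteq> carrier G" and g: "Poly_Mapping.keys g \<subseteq> carrier G"
      and h: "Poly_Mapping.keys h \<subseteq> carrier G" for f g h
    using f
  proof (induction rule: group_algebra_induct)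
    case (single x c)
    note x = single
    show ?case using g
    proof (induction rule: group_algebra_induct)
      case (single y d)
      note y = single
      show ?case using h
        by (induction rule: group_algebra_induct)
           (simp_all add: group_algebra_mult_add single_mult_single_group_algebra G.m_assoc x y
              mult.assoc)
    qed (simp_all add: group_algebra_add_mult group_algebra_mult_add)
  qed (simp_all add: group_algebra_add_mult)
  have one: "delta \<one>\<^bsub>G\<^esub> \<otimes>\<^bsub>group_algebra G\<^esub> f = f \<and> f \<otimes>\<^bsub>group_algebra G\<^esub> delta \<one>\<^bsub>G\<^esub> = f"
    if "Poly_Mapping.keys f \<subseteq> carrier G" for f
    using that
    by (induction rule: group_algebra_induct)
       (simp_all add: group_algebra_add_mult group_algebra_mult_add delta_def
          single_mult_single_group_algebra)
  show ?thesis
  proof (rule ringI)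
    show "abelian_group (group_algebra G)"
    proof (rule abelian_groupI)
      fix f assume "f \<in> carrier (group_algebra G)"
      then show "\<exists>g\<in>carrier (group_algebra G). g \<oplus>\<^bsub>group_algebra G\<^esub> f = \<zero>\<^bsub>group_algebra G\<^esub>"
        by (intro bexI[of _ "- f"]) auto
    qed (use keys_add in \<open>fastforce simp: add.assoc add.commute\<close>)+
    show "monoid (group_algebra G)"
      by (rule monoidI) (use closed assoc one in \<open>auto simp: delta_def\<close>)
  qed (simp_all add: group_algebra_add_mult group_algebra_mult_add)
qed

end

theory Submission
  imports Defs
begin

text \<open>Expanding the \<open>k\<close>-th power, the moment is \<open>(2 N)\<^sup>-\<^sup>k\<^sup>/\<^sup>2\<close> times the number of words of length
  \<open>k\<close> in the first \<open>N\<close> generators and their inverses that represent the identity of \<open>A\<close>. The words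
  that already cancel in the free group are closed walks of length \<open>k\<close> at a vertex of the
  \<open>2 N\<close>-regular tree. In such a walk a step down is forced and a step up has \<open>2 N\<close> or \<open>2 N - 1\<close>
  choices, so after division by \<open>(2 N)\<^sup>k\<^sup>/\<^sup>2\<close> their number tends to the number of Dyck paths of length
  \<open>k\<close>, a Catalan number or \<open>0\<close> (lemmas \<open>tree_walks_asymptotics\<close> and \<open>dyck_paths_eq_catalan\<close>).

  The remaining task is to see that the words that are trivial in \<open>A\<close> but not in the free group
  are negligible, and this rests on two facts about a trivial word:
  \<^item> no generator occurs exactly once in it (\<open>trivial_imp_no_singleton\<close>);
  \<^item> if every generator occurs at most twice, the word cancels freely
    (\<open>trivial_twice_imp_freely_trivial\<close>).

  Together they say that an exceptional word uses each of its indices at least twice and some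
  index at least three times. It therefore has fewer than \<open>k / 2\<close> distinct indices, and there are
  only \<open>O(N\<^sup>d)\<close> such words, with \<open>d < k / 2\<close>.

  Both facts come from linear actions of \<open>A\<close> on the functions \<open>S \<Rightarrow> \<real>\<close>, a deformation with
  parameter \<open>r\<close> of the dual of Tits' geometric representation of the Coxeter group. For \<open>r = 2\<close>
  the generator \<open>a\<^sub>i\<close> multiplies the \<open>i\<close>-th coordinate by \<open>-4\<close>, whereas the other generators fix the
  indicator function of \<open>i\<close>; hence a word with a single block \<open>a\<^sub>i\<^sup>n\<close> of the generator \<open>a\<^sub>i\<close>, \<open>n \<noteq> 0\<close>,
  is nontrivial. For \<open>r = 1\<close> the action is the numbers game of Mozes. Its coefficients are
  at least \<open>\<surd>2\<close> exactly because all labels are at least \<open>4\<close>, and this is enough to show that a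
  game started at the constant \<open>1\<close>, in which no vertex is fired more than twice or twice in a row,
  only fires positive vertices and so never comes back to its start
  (\<open>game_invariant_fire\<close>). A freely reduced word with every generator at most twice either has no
  two neighbouring letters of the same index, and the second action applies, or has a block
  \<open>a\<^sub>i\<^sup>2\<close> or \<open>a\<^sub>i\<^sup>-\<^sup>2\<close> that contains all its letters of index \<open>i\<close>, and the first action applies.\<close>

section \<open>The deformed numbers game as an action of the Artin group\<close>

text \<open>The label \<open>\<infinity>\<close> imposes no relation, so any value would give an action; the angle \<open>0\<close> is the
  limit of \<open>pi / n\<close> and keeps \<open>cos\<close> large.\<close>

definition angle :: "enat \<Rightarrow> real"
  where "angle n = (case n of enat k \<Rightarrow> pi / real k | \<infinity> \<Rightarrow> 0)"

definition coeff :: "('s \<Rightarrow> 's \<Rightarrow> enat) \<Rightarrow> real \<Rightarrow> 's \<Rightarrow> 's \<Rightarrow> real"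
  where "coeff m r k j = (if k = j then - (1 + r\<^sup>2) else 2 * r * cos (angle (m k j)))"

text \<open>Letters act on the right: a word is applied by \<open>fold\<close>, from its first letter to its last. Firing
  \<open>(j, True)\<close> multiplies the \<open>j\<close>-th coordinate by \<open>- r\<^sup>2\<close> and adds multiples of its old value to the
  others; \<open>(j, False)\<close> undoes this.\<close>

fun fire :: "('s \<Rightarrow> 's \<Rightarrow> enat) \<Rightarrow> real \<Rightarrow> 's \<times> bool \<Rightarrow> ('s \<Rightarrow> real) \<Rightarrow> 's \<Rightarrow> real"
  where "fire m r (j, b) e = (\<lambda>k. e k + coeff m r k j * ((if b then 1 else 1 / r\<^sup>2) * e j))"

lemma fire_cancel:
  assumes "r \<noteq> 0"
  shows "fire m r (j, \<not> b) (fire m r (j, b) e) = e"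
  using assms by (auto simp: coeff_def fun_eq_iff field_simps power2_eq_square)

lemma inj_fold_fire:
  assumes "r \<noteq> 0"
  shows "inj (fold (fire m r) w)"
proof (induction w)
  case (Cons x w)
  have "inj (fire m r x)"
    by (cases x) (metis assms fire_cancel injI)
  then show ?case
    using inj_compose[OF Cons] by (simp add: comp_def)
qed simp

lemma alternating_word_Suc:
  "alternating_word (Suc n) s t = alternating_word n s t @ [(if even n then s else t, True)]"
  by (simp add: alternating_word_def)

text \<open>In an alternating firing sequence of \<open>s\<close> and \<open>t\<close>, the \<open>n\<close>-th fired value satisfies a linear
  recurrence of order two, so it is a combination of the fundamental solution \<open>h\<close> and its shift.
  The total effect of the sequence is determined by these values.\<close>

lemma fold_fire_alternating_word:
  fixes h :: "nat \<Rightarrow> real" and e :: "'s \<Rightarrow> real"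
  assumes st: "s \<noteq> t" "coeff m r s t = y" "coeff m r t s = y"
    and h: "h 0 = 0" "h 1 = 1" "\<And>n. h (Suc (Suc n)) = y * h (Suc n) - r\<^sup>2 * h n"
  defines "v \<equiv> \<lambda>n. e s * h (Suc n) + e t * h n"
    and "c \<equiv> \<lambda>n :: nat. if even n then s else t"
  shows "fold (fire m r) (alternating_word n s t) e =
      (\<lambda>k. e k + (\<Sum>i<n. coeff m r k (c i) * v i))"
proof -
  define E where "E n = fold (fire m r) (alternating_word n s t) e" for n
  have step: "E (Suc n) = (\<lambda>k. E n k + coeff m r k (c n) * E n (c n))" for n
    by (auto simp: E_def c_def alternating_word_Suc fun_eq_iff)
  have v: "v (Suc (Suc n)) = y * v (Suc n) - r\<^sup>2 * v n" for n
    by (simp add: v_def h algebra_simps)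
  have y: "coeff m r (c (Suc n)) (c n) = y" for n
    using st by (simp add: c_def)
  \<comment> \<open>Between firings, the coordinate fired next holds \<open>v n\<close> and the other one \<open>- r\<^sup>2 * v (n - 1)\<close>; the
    second value is written so that it makes sense for \<open>n = 0\<close>.\<close>
  have fired: "E n (c n) = v n \<and> E n (c (Suc n)) = v (Suc n) - y * v n" for n
  proof (induction n)
    case 0
    have "h 2 = y"
      using h(1,2) h(3)[of 0] by (simp add: numeral_2_eq_2)
    then show ?case
      using h(1,2)
      by (simp add: E_def alternating_word_def v_def c_def numeral_2_eq_2 algebra_simps)
  next
    case (Suc n)
    have "E (Suc n) (c (Suc n)) = v (Suc n)"
      using Suc by (simp add: step y)
    moreover have "E (Suc n) (c n) = - r\<^sup>2 * v n"
      using Suc by (simp add: step coeff_def algebra_simps)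
    moreover have "c (Suc (Suc n)) = c n"
      by (simp add: c_def)
    ultimately show ?case by (simp add: v)
  qed
  have "E n = (\<lambda>k. e k + (\<Sum>i<n. coeff m r k (c i) * v i))" for n
  proof (induction n)
    case 0
    then show ?case by (simp add: E_def alternating_word_def)
  next
    case (Suc n)
    then show ?case using fired[of n] by (simp add: step add.assoc)
  qed
  then show ?thesis by (simp add: E_def)
qed

text \<open>The sequences \<open>s t s \<dots>\<close> and \<open>t s t \<dots>\<close> of length \<open>n\<close> add to each coordinate the same sums of
  values of \<open>h\<close>, taken over indices of one parity, except that one of them is shifted by one
  place; the boundary terms \<open>h 0\<close> and \<open>h n\<close> vanish.\<close>

lemma fire_braid:
  fixes h :: "nat \<Rightarrow> real"
  assumes st: "s \<noteq> t" "coeff m r s t = y" "coeff m r t s = y"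
    and h: "h 0 = 0" "h 1 = 1" "\<And>n. h (Suc (Suc n)) = y * h (Suc n) - r\<^sup>2 * h n"
    and hn: "h n = 0"
  shows "fold (fire m r) (alternating_word n s t) e = fold (fire m r) (alternating_word n t s) e"
proof -
  have shift: "(\<Sum>i<n. f (Suc i) * h (Suc i)) = (\<Sum>i<n. f i * h i)" for f :: "nat \<Rightarrow> real"
    using sum.lessThan_Suc_shift[of "\<lambda>i. f i * h i" n] by (simp add: h(1) hn)
  have "(\<Sum>i<n. coeff m r k (if even i then s else t) * (e s * h (Suc i) + e t * h i)) =
      (\<Sum>i<n. coeff m r k (if even i then t else s) * (e t * h (Suc i) + e s * h i))" for k
  proof -
    define F where "F i = coeff m r k (if even i then s else t)" for i :: nat
    define F' where "F' i = coeff m r k (if even i then t else s)" for i :: nat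
    have F: "F' (Suc i) = F i" "F (Suc i) = F' i" for i
      by (simp_all add: F_def F'_def)
    have "(\<Sum>i<n. F i * (e s * h (Suc i) + e t * h i)) =
        e s * (\<Sum>i<n. F' (Suc i) * h (Suc i)) + e t * (\<Sum>i<n. F i * h i)"
      by (simp add: F sum_distrib_left sum.distrib[symmetric] algebra_simps)
    also have "\<dots> = e s * (\<Sum>i<n. F' i * h i) + e t * (\<Sum>i<n. F (Suc i) * h (Suc i))"
      by (simp only: shift)
    also have "\<dots> = (\<Sum>i<n. F' i * (e t * h (Suc i) + e s * h i))"
      by (simp add: F sum_distrib_left sum.distrib[symmetric] algebra_simps)
    finally show ?thesis by (simp add: F_def F'_def)
  qed
  then show ?thesis
    using fold_fire_alternating_word[of s t m r y h, OF st h]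
      fold_fire_alternating_word[of t s m r y h, OF st(1)[symmetric] st(3,2) h]
    by simp
qed

text \<open>With off-diagonal coefficients \<open>2 r cos \<theta>\<close>, \<open>\<theta> = pi / n\<close>, the fundamental solution is
  \<open>h i = r\<^sup>i\<^sup>-\<^sup>1 sin (i \<theta>) / sin \<theta>\<close>, which vanishes at \<open>i = n\<close>. So the braid relations hold and the
  group acts.\<close>

lemma fold_fire_pres_eq:
  assumes "pres_eq S (artin_relations S m) u v" and "coxeter_matrix S m" and "r > 0"
  shows "fold (fire m r) u e = fold (fire m r) v e"
  using assms(1)
proof (induction arbitrary: e rule: pres_eq.induct)
  case (cancel x u v b)
  show ?case
    using fire_cancel[of r m x b "fold (fire m r) u e"] \<open>r > 0\<close> by (simp del: fire.simps)
next
  case (relation l r' u v)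
  then obtain n s t where st: "s \<in> S" "t \<in> S" "s \<noteq> t" "m s t = enat n"
    and l: "l = alternating_word n s t" "r' = alternating_word n t s"
    by (auto simp: artin_relations_def)
  have sym: "m t s = enat n"
    using assms(2) st by (auto simp: coxeter_matrix_def)
  have n: "n \<ge> 2"
    using assms(2) st by (force simp: coxeter_matrix_def numeral_eq_enat)
  define \<theta> where "\<theta> = pi / real n"
  have "0 < \<theta>" "\<theta> < pi"
    using n by (auto simp: \<theta>_def field_simps)
  then have sin: "sin \<theta> > 0" by (rule sin_gt_zero)
  define h where "h i = r ^ i * sin (real i * \<theta>) / (r * sin \<theta>)" for i
  have y: "coeff m r s t = 2 * r * cos \<theta>" "coeff m r t s = 2 * r * cos \<theta>"
    using st sym by (auto simp: coeff_def angle_def \<theta>_def)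
  have rec: "h (Suc (Suc i)) = 2 * r * cos \<theta> * h (Suc i) - r\<^sup>2 * h i" for i
  proof -
    define \<phi> where "\<phi> = real i * \<theta>"
    have "real (Suc (Suc i)) * \<theta> = \<phi> + \<theta> + \<theta>" "real (Suc i) * \<theta> = \<phi> + \<theta>"
      by (simp_all add: \<phi>_def algebra_simps)
    moreover have "sin (\<phi> + \<theta> + \<theta>) = 2 * cos \<theta> * sin (\<phi> + \<theta>) - sin \<phi>"
    proof -
      have "sin (\<phi> + \<theta> + \<theta>) + sin (\<phi> + \<theta> - \<theta>) = 2 * cos \<theta> * sin (\<phi> + \<theta>)"
        by (simp only: sin_add[of "\<phi> + \<theta>"] sin_diff[of "\<phi> + \<theta>"]) simp
      then show ?thesis by simp
    qed
    ultimately have "h (Suc (Suc i)) =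
        r ^ Suc (Suc i) * (2 * cos \<theta> * sin (\<phi> + \<theta>) - sin \<phi>) / (r * sin \<theta>)"
      and "h (Suc i) = r ^ Suc i * sin (\<phi> + \<theta>) / (r * sin \<theta>)"
      and "h i = r ^ i * sin \<phi> / (r * sin \<theta>)"
      by (simp_all only: h_def \<phi>_def[symmetric])
    then show ?thesis
      by (simp add: diff_divide_distrib algebra_simps power2_eq_square)
  qed
  have "fold (fire m r) l = fold (fire m r) r'"
    unfolding l
    by (rule ext, rule fire_braid[OF st(3) y, of h])
      (use n sin \<open>r > 0\<close> rec in \<open>auto simp: h_def \<theta>_def\<close>)
  then show ?case by simp
qed simp_all

section \<open>Nontrivial words\<close>

lemma fold_fire_away:
  assumes "\<And>x. x \<in> set w \<Longrightarrow> e (fst x) = 0"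
  shows "fold (fire m r) w e = e"
  using assms
proof (induction w)
  case (Cons x w)
  have "fire m r x e = e"
    using Cons.prems[of x] by (cases x) (simp add: fun_eq_iff)
  then show ?case using Cons by simp
qed simp

text \<open>The indicator function of \<open>i\<close> is fixed by all letters of other indices, while a nonzero power of
  \<open>a\<^sub>i\<close> multiplies its \<open>i\<close>-th coordinate by a power of \<open>-4\<close> or \<open>-1/4\<close>.\<close>

lemma isolated_power_nontrivial:
  assumes cox: "coxeter_matrix S m"
    and w: "pres_eq S (artin_relations S m) (p @ replicate (Suc n) (i, b) @ q) []"
    and i: "i \<notin> fst ` set p" "i \<notin> fst ` set q"
  shows False
proof -
  define r :: real where "r = 2"
  define e :: "'a \<Rightarrow> real" where "e k = (if k = i then 1 else 0)" for k
  define z :: real where "z = (if b then - 4 else - 1 / 4)"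
  have fixed: "fold (fire m r) p e = e" "fold (fire m r) q e = e"
    by (intro fold_fire_away; use i in \<open>force simp: e_def\<close>)+
  have pow: "fold (fire m r) (replicate l (i, b)) f i = z ^ l * f i" for l f
  proof (induction l arbitrary: f)
    case (Suc l)
    have "fire m r (i, b) f i = z * f i"
      by (simp add: coeff_def r_def z_def algebra_simps)
    then show ?case using Suc by (simp del: fire.simps)
  qed simp
  have "fold (fire m r) q (fold (fire m r) (replicate (Suc n) (i, b)) e) = e"
    using fold_fire_pres_eq[OF w cox, of r e] fixed by (simp add: r_def)
  then have "fold (fire m r) (replicate (Suc n) (i, b)) e = e"
    using fixed(2) inj_fold_fire[of r m q] by (metis injD r_def zero_neq_numeral)
  then have "z ^ Suc n = 1"
    using pow[of "Suc n" e] by (simp add: e_def)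
  then have "\<bar>z\<bar> ^ Suc n = 1" by (metis abs_1 power_abs)
  then have "\<bar>z\<bar> = 1" using power_eq_imp_eq_base[of "\<bar>z\<bar>" "Suc n" 1] by simp
  then show False by (simp add: z_def split: if_splits)
qed

lemma sqrt2_le_coeff:
  assumes "n \<ge> 4"
  shows "2 * cos (angle n) \<ge> sqrt 2"
proof (cases n)
  case (enat k)
  then have "real k \<ge> 4"
    using assms by (simp add: numeral_eq_enat)
  then have "pi / real k \<le> pi / 4"
    by (intro divide_left_mono) auto
  moreover have "0 \<le> pi / real k" by simp
  ultimately have "cos (pi / real k) \<ge> cos (pi / 4)"
    by (intro cos_monotone_0_pi_le) auto
  then show ?thesis using enat by (simp add: angle_def cos_45)
next
  case infinity
  have "sqrt 2 \<le> sqrt 4" by (intro real_sqrt_le_mono) simp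
  then show ?thesis using infinity by (simp add: angle_def)
qed

text \<open>The state of the numbers game after at least one move: \<open>e\<close> is the position, \<open>l\<close> the vertex fired
  last, and \<open>fired k\<close> the number of times \<open>k\<close> has been fired. Only vertices fired less than twice may
  still be used. The second clause says that every legal next move fires a positive value. The
  third makes it survive: since every coefficient is at least \<open>\<surd>2\<close>, firing \<open>k\<close> turns the negative
  coordinate at \<open>l\<close> positive. The fourth serves to reestablish the third for \<open>l\<close> when
  the fired vertex is fresh.\<close>

definition game_invariant :: "'s set \<Rightarrow> ('s \<Rightarrow> real) \<Rightarrow> 's \<Rightarrow> ('s \<Rightarrow> nat) \<Rightarrow> bool"
  where "game_invariant S e l fired \<longleftrightarrow>
    e l < 0 \<and>
    (\<forall>k\<in>S. fired k < 2 \<longrightarrow> k \<noteq> l \<longrightarrow> e k > 0) \<and>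
    (fired l < 2 \<longrightarrow>
      (\<forall>k\<in>S. fired k < 2 \<longrightarrow> k \<noteq> l \<longrightarrow> sqrt 2 * e k > - e l) \<and>
      (\<forall>k\<in>S. fired k = 0 \<longrightarrow> e k > - (sqrt 2 * e l)))"

text \<open>All available coordinates except the one at \<open>l\<close> are positive, and firing \<open>j\<close> raises every other
  coordinate by at least \<open>\<surd>2\<close> times the fired value. The critical coordinate is the one at \<open>l\<close>, when
  \<open>j\<close> is fired for the first time: the new value is at least \<open>e l + \<surd>2 e j\<close>,
  and \<open>\<surd>2 (e l + \<surd>2 e j) = 2 e j + \<surd>2 e l > e j\<close> by the last
  clause of the invariant for \<open>j\<close>.\<close>

lemma game_invariant_fire:
  assumes inv: "game_invariant S e l fired"
    and l: "l \<in> S" "fired l > 0"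
    and j: "j \<in> S" "fired j < 2" "j \<noteq> l"
    and c: "c j = - 2" "\<And>k. k \<in> S \<Longrightarrow> k \<noteq> j \<Longrightarrow> c k \<ge> sqrt 2"
  shows "game_invariant S (\<lambda>k. e k + c k * e j) j (fired(j := Suc (fired j)))"
proof -
  let ?e = "\<lambda>k. e k + c k * e j" and ?fired = "fired(j := Suc (fired j))"
  have pos: "e k > 0" if "k \<in> S" "fired k < 2" "k \<noteq> l" for k
    using inv that by (simp add: game_invariant_def)
  have once: "sqrt 2 * e k > - e l" if "fired l < 2" "k \<in> S" "fired k < 2" "k \<noteq> l" for k
    using inv that by (simp add: game_invariant_def)
  have never: "e k > - (sqrt 2 * e l)" if "fired l < 2" "k \<in> S" "fired k = 0" for k
    using inv that by (simp add: game_invariant_def)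
  have ej: "e j > 0" using pos j by blast
  have grow: "?e k \<ge> e k + sqrt 2 * e j" if "k \<in> S" "k \<noteq> j" for k
    using mult_right_mono[OF c(2)[of k], of "e j"] that ej by simp
  have "?e k > 0" if "k \<in> S" "fired k < 2" "k \<noteq> j" for k
  proof (cases "k = l")
    case True
    then show ?thesis using grow[of l] once[of j] j that l by simp
  next
    case False
    have "sqrt 2 * e j > 0" using ej by simp
    then show ?thesis using grow[of k] pos[of k] that False by simp
  qed
  moreover have "sqrt 2 * ?e k > e j" if "fired j = 0" "k \<in> S" "fired k < 2" "k \<noteq> j" for k
  proof -
    have lower: "sqrt 2 * ?e k \<ge> sqrt 2 * e k + 2 * e j"
      using mult_left_mono[OF grow[of k], of "sqrt 2"] that
      by (simp add: distrib_left mult.assoc[symmetric])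
    show ?thesis
    proof (cases "k = l")
      case True
      then show ?thesis using never[of j] lower that j by simp
    next
      case False
      have "sqrt 2 * e k > 0" using pos[of k] that False by simp
      then show ?thesis using lower ej by simp
    qed
  qed
  moreover have "?e k > sqrt 2 * e j" if "k \<in> S" "fired k = 0" "k \<noteq> j" for k
    using grow[of k] pos[of k] that l by (cases "k = l") auto
  ultimately show ?thesis
    using ej c(1) by (auto simp: game_invariant_def)
qed

text \<open>For \<open>r = 1\<close> a generator and its inverse act in the same way, so only the indices of the letters
  matter.\<close>

lemma numbers_game:
  fixes us :: "'s word"
  assumes m: "\<And>x y. x \<in> S \<Longrightarrow> y \<in> S \<Longrightarrow> x \<noteq> y \<Longrightarrow> m x y \<ge> 4"
    and us: "us \<noteq> []" "us \<in> words S" "distinct_adj (map fst us)"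
      "\<And>j. count_list (map fst us) j \<le> 2"
  shows "game_invariant S (fold (fire m 1) us (\<lambda>_. 1)) (fst (last us)) (count_list (map fst us))"
  using us
proof (induction us rule: rev_nonempty_induct)
  case (single a)
  have "coeff m 1 k (fst a) \<ge> sqrt 2" if "k \<in> S" "k \<noteq> fst a" for k
    using sqrt2_le_coeff[OF m[of k "fst a"]] single that by (simp add: coeff_def)
  moreover have "sqrt 2 * (1 + c) > 1" "1 + c > 0" if "c \<ge> sqrt 2" for c
  proof -
    have "c \<ge> 1" using that real_sqrt_gt_1_iff[of 2] by linarith
    then have "sqrt 2 * (1 + c) \<ge> sqrt 2 * 1"
      by (intro mult_left_mono) auto
    then show "sqrt 2 * (1 + c) > 1" using real_sqrt_gt_1_iff[of 2] by linarith
    show "1 + c > 0" using \<open>c \<ge> 1\<close> by simp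
  qed
  ultimately show ?case
    by (cases a) (force simp: game_invariant_def coeff_def)
next
  case (snoc a us)
  define j where "j = fst a"
  have "game_invariant S (fold (fire m 1) us (\<lambda>_. 1)) (fst (last us)) (count_list (map fst us))"
  proof (rule snoc.IH)
    show "distinct_adj (map fst us)"
      using snoc.prems(2) by (simp add: distinct_adj_append_iff)
    show "count_list (map fst us) i \<le> 2" for i
      using snoc.prems(3)[of i] by simp
  qed (use snoc.prems in simp)
  moreover have "last us \<in> set us" using snoc.hyps by simp
  then have "fst (last us) \<in> S" "count_list (map fst us) (fst (last us)) > 0"
    using snoc.prems(1) count_list_0_iff[of "map fst us" "fst (last us)"] by (auto simp: words_def)
  moreover have "j \<in> S" "count_list (map fst us) j < 2" "j \<noteq> fst (last us)"
    using snoc.prems snoc.prems(3)[of j] snoc.hyps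
    by (auto simp: j_def distinct_adj_append_iff last_map)
  moreover have "coeff m 1 j j = - 2" by (simp add: coeff_def)
  moreover have "coeff m 1 k j \<ge> sqrt 2" if "k \<in> S" "k \<noteq> j" for k
    using sqrt2_le_coeff[OF m[of k j]] \<open>j \<in> S\<close> that by (simp add: coeff_def)
  ultimately have "game_invariant S
      (\<lambda>k. fold (fire m 1) us (\<lambda>_. 1) k + coeff m 1 k j * fold (fire m 1) us (\<lambda>_. 1) j) j
      ((count_list (map fst us))(j := Suc (count_list (map fst us) j)))"
    by (rule game_invariant_fire)
  moreover have "fold (fire m 1) (us @ [a]) (\<lambda>_. 1) =
      (\<lambda>k. fold (fire m 1) us (\<lambda>_. 1) k + coeff m 1 k j * fold (fire m 1) us (\<lambda>_. 1) j)"
    by (cases a) (simp add: j_def)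
  moreover have "count_list (map fst (us @ [a])) =
      (count_list (map fst us))(j := Suc (count_list (map fst us) j))"
    by (auto simp: j_def)
  ultimately show ?case by (simp only: last_snoc j_def[symmetric])
qed

text \<open>The game started at the constant \<open>1\<close> ends with a negative coordinate at the vertex fired last.\<close>

lemma twice_occurring_nontrivial:
  fixes us :: "'s word"
  assumes cox: "coxeter_matrix S m"
    and m: "\<And>x y. x \<in> S \<Longrightarrow> y \<in> S \<Longrightarrow> x \<noteq> y \<Longrightarrow> m x y \<ge> 4"
    and us: "us \<noteq> []" "us \<in> words S" "distinct_adj (map fst us)"
      "\<And>j. count_list (map fst us) j \<le> 2"
  shows "\<not> pres_eq S (artin_relations S m) us []"
proof
  assume "pres_eq S (artin_relations S m) us []"
  then have "fold (fire m 1) us (\<lambda>_. 1) = (\<lambda>_. 1)"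
    using fold_fire_pres_eq[OF _ cox, of us "[]" 1] by simp
  then show False
    using numbers_game[of S m us, OF m us] by (simp add: game_invariant_def)
qed

section \<open>Free reduction\<close>

definition flip :: "'x \<times> bool \<Rightarrow> 'x \<times> bool"
  where "flip x = (fst x, \<not> snd x)"

lemma flip_flip [simp]: "flip (flip x) = x"
  by (simp add: flip_def)

text \<open>The stack holds the reduced form of the prefix read so far, last letter on top.\<close>

fun push :: "'x \<times> bool \<Rightarrow> 'x word \<Rightarrow> 'x word"
  where
    "push x [] = [x]"
  | "push x (y # ys) = (if y = flip x then ys else x # y # ys)"

definition free_reduction :: "'x word \<Rightarrow> 'x word"
  where "free_reduction w = rev (fold push w [])"

lemma pres_eq_fold_push:
  assumes "w \<in> words X" "st \<in> words X"
  shows "pres_eq X R (rev st @ w) (rev (fold push w st))"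
  using assms
proof (induction w arbitrary: st)
  case Nil
  then have "rev st \<in> words X" by (auto simp: words_def)
  then show ?case by (simp add: pres_eq.refl)
next
  case (Cons x w)
  have "push x st \<in> words X \<and> pres_eq X R (rev st @ x # w) (rev (push x st) @ w)"
  proof (cases "\<exists>ys. st = flip x # ys")
    case True
    then obtain ys where ys: "st = flip x # ys" ..
    have "pres_eq X R (rev ys @ [(fst x, \<not> snd x), (fst x, \<not> \<not> snd x)] @ w) (rev ys @ w)"
      by (rule pres_eq.cancel) (use Cons.prems ys in \<open>auto simp: words_def\<close>)
    then show ?thesis using Cons.prems ys by (simp add: flip_def)
  next
    case False
    then have "push x st = x # st" by (cases st) auto
    moreover have "rev st @ x # w \<in> words X"
      using Cons.prems by (auto simp: words_def)
    ultimately show ?thesis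
      using Cons.prems pres_eq.refl[of "rev st @ x # w" X R] by simp
  qed
  then show ?case
    using Cons.IH[of "push x st"] Cons.prems pres_eq.trans by fastforce
qed

lemma pres_eq_free_reduction:
  "w \<in> words X \<Longrightarrow> pres_eq X R w (free_reduction w)"
  using pres_eq_fold_push[of w X "[]" R] by (simp add: free_reduction_def)

lemma successively_push:
  "successively (\<lambda>x y. y \<noteq> flip x) st \<Longrightarrow> successively (\<lambda>x y. y \<noteq> flip x) (push x st)"
  by (cases st) (auto simp: successively_Cons)

lemma successively_free_reduction:
  "successively (\<lambda>x y. y \<noteq> flip x) (free_reduction w)"
proof -
  have "successively (\<lambda>x y. y \<noteq> flip x) (fold push w st)"
    if "successively (\<lambda>x y. y \<noteq> flip x) st" for st
    using that by (induction w arbitrary: st) (simp_all add: successively_push)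
  then have "successively (\<lambda>x y. y \<noteq> flip x) (fold push w [])" by simp
  moreover have "x \<noteq> flip y \<longleftrightarrow> y \<noteq> flip x" for x y :: "'a \<times> bool"
    by (metis flip_flip)
  ultimately show ?thesis by (simp add: free_reduction_def)
qed

lemma count_free_reduction:
  "count_list (map fst (free_reduction w)) j \<le> count_list (map fst w) j"
proof -
  have push: "count_list (map fst (push x st)) j \<le> count_list (map fst [x]) j + count_list (map fst st) j"
    for x and st :: "'a word"
    by (cases st) auto
  have "count_list (map fst (fold push w st)) j \<le>
      count_list (map fst w) j + count_list (map fst st) j" for st
  proof (induction w arbitrary: st)
    case (Cons x w)
    show ?case using Cons[of "push x st"] push[of x st] by (auto split: if_splits)
  qed simp
  moreover have "map fst (free_reduction w) = rev (map fst (fold push w []))"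
    by (simp add: free_reduction_def rev_map)
  ultimately show ?thesis by (metis add.right_neutral count_list.simps(1) count_list_rev list.map(1))
qed

text \<open>Free reduction does not increase the number of occurrences. In a nonempty reduced word, neighbouring
  letters of equal index are equal letters, and they are then the only two occurrences of this
  index; \<open>isolated_power_nontrivial\<close> excludes them and \<open>twice_occurring_nontrivial\<close> excludes words
  without such neighbours.\<close>

lemma trivial_twice_imp_freely_trivial:
  fixes w :: "'s word"
  assumes cox: "coxeter_matrix S m"
    and m: "\<And>x y. x \<in> S \<Longrightarrow> y \<in> S \<Longrightarrow> x \<noteq> y \<Longrightarrow> m x y \<ge> 4"
    and w: "pres_eq S (artin_relations S m) w []"
      "\<And>j. count_list (map fst w) j \<le> 2"
  shows "free_reduction w = []"
proof (rule ccontr)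
  define v where "v = free_reduction w"
  assume "free_reduction w \<noteq> []"
  then have v: "v \<noteq> []" by (simp add: v_def)
  have "w \<in> words S" using pres_eq_words[OF w(1)] by simp
  then have trivial: "pres_eq S (artin_relations S m) v []"
    using w(1) unfolding v_def by (metis pres_eq_free_reduction pres_eq.sym pres_eq.trans)
  have words: "v \<in> words S" using pres_eq_words[OF trivial] by simp
  have twice: "count_list (map fst v) j \<le> 2" for j
    using count_free_reduction[of w j] w(2)[of j] by (simp add: v_def)
  show False
  proof (cases "distinct_adj (map fst v)")
    case True
    then show False
      using twice_occurring_nontrivial[of S m v, OF cox m v words True twice] trivial by blast
  next
    case False
    then obtain p x y q where v: "v = p @ [x, y] @ q" "fst x = fst y"
    proof -
      obtain i where i: "Suc i < length v" "fst (v ! i) = fst (v ! Suc i)"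
        using False by (auto simp: distinct_adj_conv_nth)
      then have "v = take i v @ [v ! i, v ! Suc i] @ drop (Suc (Suc i)) v"
        by (simp add: Cons_nth_drop_Suc)
      then show thesis using that i(2) by blast
    qed
    have "y \<noteq> flip x"
      using successively_free_reduction[of w] v(1)
      by (simp add: v_def[symmetric] successively_append_iff)
    then have yx: "y = x" using v(2) by (cases x; cases y) (simp add: flip_def)
    then have "pres_eq S (artin_relations S m) (p @ replicate (Suc 1) (fst x, snd x) @ q) []"
      using trivial v(1) by simp
    moreover have "fst x \<notin> fst ` set p" "fst x \<notin> fst ` set q"
      using twice[of "fst x"] v(1)[unfolded yx] count_list_0_iff[of "map fst p" "fst x"]
        count_list_0_iff[of "map fst q" "fst x"] by auto
    ultimately show False by (rule isolated_power_nontrivial[OF cox])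
  qed
qed

lemma trivial_imp_no_singleton:
  assumes cox: "coxeter_matrix S m"
    and w: "pres_eq S (artin_relations S m) w []"
  shows "count_list (map fst w) i \<noteq> 1"
proof
  assume 1: "count_list (map fst w) i = 1"
  then have "i \<in> set (map fst w)"
    using count_list_0_iff[of "map fst w" i] by force
  then obtain b where "(i, b) \<in> set w" by auto
  then obtain p q where v: "w = p @ [(i, b)] @ q"
    using split_list[of "(i, b)" w] by auto
  have "i \<notin> fst ` set p" "i \<notin> fst ` set q"
    using 1 v count_list_0_iff[of "map fst p" i] count_list_0_iff[of "map fst q" i] by auto
  then show False
    using isolated_power_nontrivial[OF cox, of p 0 i b q] w v by simp
qed

text \<open>Every index occurs at least twice, so at least \<open>length w / 2\<close> indices would force all of them to
  occur exactly twice.\<close>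

lemma trivial_imp_few_indices:
  fixes w :: "'s word"
  assumes cox: "coxeter_matrix S m"
    and m: "\<And>x y. x \<in> S \<Longrightarrow> y \<in> S \<Longrightarrow> x \<noteq> y \<Longrightarrow> m x y \<ge> 4"
    and w: "pres_eq S (artin_relations S m) w []" "free_reduction w \<noteq> []"
  shows "2 * card (fst ` set w) < length w"
proof (rule ccontr)
  assume less: "\<not> 2 * card (fst ` set w) < length w"
  let ?c = "count_list (map fst w)"
  have ge2: "?c j \<ge> 2" if "j \<in> fst ` set w" for j
  proof -
    have "?c j \<noteq> 0" using that by (simp add: count_list_0_iff)
    then show ?thesis using trivial_imp_no_singleton[OF cox w(1), of j] by linarith
  qed
  have sum: "(\<Sum>j\<in>fst ` set w. ?c j) = length w"
    using sum_count_set[of "map fst w" "fst ` set w"] by simp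
  have "?c j \<le> 2" for j
  proof (rule ccontr)
    assume j: "\<not> ?c j \<le> 2"
    then have "?c j \<noteq> 0" by linarith
    then have "j \<in> fst ` set w" by (simp add: count_list_0_iff)
    then have "(\<Sum>i\<in>fst ` set w. 2) < (\<Sum>i\<in>fst ` set w. ?c i)"
      using j ge2 by (intro sum_strict_mono_ex1) (use \<open>j \<in> fst ` set w\<close> in \<open>auto simp: not_le intro: bexI[of _ j]\<close>)
    then show False using less sum by simp
  qed
  then show False
    using trivial_twice_imp_freely_trivial[of S m w, OF cox m w(1)] w(2) by blast
qed

section \<open>Counting freely trivial words\<close>

text \<open>The number of walks of length \<open>n\<close> in the \<open>d\<close>-regular tree from a vertex at distance \<open>h\<close> from the root
  to the root.\<close>

fun tree_walks :: "nat \<Rightarrow> nat \<Rightarrow> nat \<Rightarrow> nat"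
  where
    "tree_walks d 0 h = (if h = 0 then 1 else 0)"
  | "tree_walks d (Suc n) 0 = d * tree_walks d n 1"
  | "tree_walks d (Suc n) (Suc h) = (d - 1) * tree_walks d n (Suc (Suc h)) + tree_walks d n h"

text \<open>The number of paths of length \<open>n\<close> with steps \<open>1\<close> and \<open>-1\<close> that lead from height \<open>h\<close> to \<open>0\<close> and
  stay nonnegative.\<close>

fun dyck_paths :: "nat \<Rightarrow> nat \<Rightarrow> nat"
  where
    "dyck_paths 0 h = (if h = 0 then 1 else 0)"
  | "dyck_paths (Suc n) 0 = dyck_paths n 1"
  | "dyck_paths (Suc n) (Suc h) = dyck_paths n (Suc (Suc h)) + dyck_paths n h"

text \<open>Exactly one letter of \<open>L\<close>, the inverse of the top, shortens a nonempty stack; each of the others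
  lengthens it. Hence only the height of the stack matters.\<close>

lemma card_fold_push_eq_tree_walks:
  fixes L :: "('x \<times> bool) set"
  assumes L: "finite L" "flip ` L \<subseteq> L" and st: "set st \<subseteq> L"
  shows "card {w. set w \<subseteq> L \<and> length w = n \<and> fold push w st = []} =
    tree_walks (card L) n (length st)"
  using st
proof (induction n arbitrary: st)
  case 0
  have "{w. set w \<subseteq> L \<and> length w = 0 \<and> fold push w st = []} = (if st = [] then {[]} else {})"
    by auto
  then show ?case by auto
next
  case (Suc n)
  let ?W = "\<lambda>n st. {w. set w \<subseteq> L \<and> length w = n \<and> fold push w st = []}"
  have fin: "finite (?W n st)" for n st
    by (rule finite_subset[OF _ finite_lists_length_eq[OF L(1), of n]]) auto
  have push: "set (push x st) \<subseteq> L" if "x \<in> L" for x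
    using Suc.prems that by (cases st) auto
  have "?W (Suc n) st = (\<Union>x\<in>L. (#) x ` ?W n (push x st))"
    by (auto simp: length_Suc_conv)
  then have "card (?W (Suc n) st) = (\<Sum>x\<in>L. card ((#) x ` ?W n (push x st)))"
    using L(1) fin by (simp, subst card_UN_disjoint) auto
  also have "\<dots> = (\<Sum>x\<in>L. tree_walks (card L) n (length (push x st)))"
  proof (rule sum.cong[OF HOL.refl])
    fix x assume "x \<in> L"
    have "card ((#) x ` ?W n (push x st)) = card (?W n (push x st))"
      by (rule card_image) (simp add: inj_on_def)
    also have "\<dots> = tree_walks (card L) n (length (push x st))"
      using push[OF \<open>x \<in> L\<close>] by (rule Suc.IH)
    finally show "card ((#) x ` ?W n (push x st)) = tree_walks (card L) n (length (push x st))" .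
  qed
  also have "\<dots> = tree_walks (card L) (Suc n) (length st)"
  proof (cases st)
    case Nil
    then show ?thesis by simp
  next
    case (Cons y ys)
    have y: "flip y \<in> L" using Suc.prems L(2) Cons by auto
    have "(\<Sum>x\<in>L. tree_walks (card L) n (length (push x st))) =
        tree_walks (card L) n (length ys) +
        (\<Sum>x\<in>L - {flip y}. tree_walks (card L) n (length (push x st)))"
      using Cons by (subst sum.remove[OF L(1) y]) simp
    also have "(\<Sum>x\<in>L - {flip y}. tree_walks (card L) n (length (push x st))) =
        (\<Sum>x\<in>L - {flip y}. tree_walks (card L) n (Suc (Suc (length ys))))"
    proof (intro sum.cong HOL.refl)
      fix x assume "x \<in> L - {flip y}"
      then have "y \<noteq> flip x" by auto
      then show "tree_walks (card L) n (length (push x st)) =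
          tree_walks (card L) n (Suc (Suc (length ys)))"
        using Cons by simp
    qed
    finally show ?thesis using Cons y L(1) by simp
  qed
  finally show ?case .
qed

text \<open>A walk from height \<open>h\<close> to \<open>0\<close> has \<open>(n - h) / 2\<close> steps up, each contributing a factor asymptotic to
  \<open>d\<close>. Powers of \<open>sqrt d\<close> make the normalization uniform in the parity of \<open>n - h\<close>; the recursion for
  the normalized numbers then tends to the one for Dyck paths.\<close>

lemma tree_walks_asymptotics:
  "(\<lambda>d. real (tree_walks d n h) * sqrt (real d) ^ h / sqrt (real d) ^ n)
    \<longlonglongrightarrow> real (dyck_paths n h)"
proof (induction n arbitrary: h)
  case 0
  then show ?case by (cases h) (simp_all)
next
  case (Suc n)
  let ?f = "\<lambda>h d. real (tree_walks d n h) * sqrt (real d) ^ h / sqrt (real d) ^ n"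
  show ?case
  proof (cases h)
    case 0
    have "eventually (\<lambda>d. ?f 1 d =
        real (tree_walks d (Suc n) h) * sqrt (real d) ^ h / sqrt (real d) ^ Suc n) sequentially"
      using eventually_gt_at_top[of "0::nat"]
    proof eventually_elim
      case (elim d)
      then have "sqrt (real d) > 0" "real d = sqrt (real d) * sqrt (real d)" by simp_all
      then show ?case using 0 by (simp add: field_simps)
    qed
    then show ?thesis
      using Suc[of 1] 0 by (auto intro: Lim_transform_eventually)
  next
    case h: (Suc h')
    have "(\<lambda>d. (1 - 1 / real d) * ?f (Suc h) d + ?f h' d)
        \<longlonglongrightarrow> (1 - 0) * real (dyck_paths n (Suc h)) + real (dyck_paths n h')"
      by (intro tendsto_intros Suc lim_1_over_n)
    moreover have "eventually (\<lambda>d. (1 - 1 / real d) * ?f (Suc h) d + ?f h' d =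
        real (tree_walks d (Suc n) h) * sqrt (real d) ^ h / sqrt (real d) ^ Suc n) sequentially"
      using eventually_gt_at_top[of "0::nat"]
    proof eventually_elim
      case (elim d)
      define x where "x = sqrt (real d)"
      have x: "x > 0" "real d = x * x" using elim by (simp_all add: x_def)
      define v where "v = real (tree_walks d n (Suc h))"
      define u where "u = real (tree_walks d n h')"
      have "real (tree_walks d (Suc n) h) = (x * x - 1) * v + u"
        using elim h by (simp add: of_nat_diff v_def u_def x(2)[symmetric])
      moreover have "(1 - 1 / (x * x)) * (v * x ^ Suc h / x ^ n) + u * x ^ h' / x ^ n =
          ((x * x - 1) * v + u) * x ^ h / x ^ Suc n"
        using h x(1) by (simp add: field_simps)
      ultimately show ?case
        unfolding v_def[symmetric] u_def[symmetric] x_def[symmetric] by (simp only: x(2))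
    qed
    ultimately show ?thesis
      using h by (auto intro: Lim_transform_eventually)
  qed
qed

lemma dyck_paths_eq_0:
  "n < h \<or> odd (n + h) \<Longrightarrow> dyck_paths n h = 0"
proof (induction n arbitrary: h)
  case (Suc n)
  show ?case
  proof (cases h)
    case 0
    then have "odd (n + 1)" using Suc.prems by simp
    then show ?thesis using Suc.IH[of 1] 0 by simp
  next
    case (Suc h')
    then have "n < h' \<or> odd (n + h')" "n < h' + 2 \<or> odd (n + (h' + 2))"
      using Suc.prems by auto
    then show ?thesis using Suc.IH[of h'] Suc.IH[of "h' + 2"] Suc by simp
  qed
qed (auto simp: odd_pos)

text \<open>The reflection principle: with \<open>p\<close> steps up, \<open>n choose p\<close> unrestricted paths minus the
  \<open>n choose (p - 1)\<close> that go below \<open>0\<close>. The recursion is Pascal's rule.\<close>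

lemma dyck_paths_eq_choose_diff:
  "dyck_paths (h + 2 * p) h + (if p = 0 then 0 else (h + 2 * p) choose (p - 1)) =
    (h + 2 * p) choose p"
proof -
  have "dyck_paths n h + (if p = 0 then 0 else n choose (p - 1)) = n choose p"
    if "n = h + 2 * p" for n
    using that
  proof (induction n arbitrary: h p)
    case (Suc n)
    show ?case
    proof (cases h)
      case 0
      then obtain q where q: "p = Suc q" "n = 1 + 2 * q" using Suc.prems by (cases p) auto
      then have "n choose p = n choose q"
        using binomial_symmetric[of p n] by simp
      moreover have "dyck_paths n 1 + (if q = 0 then 0 else n choose (q - 1)) = n choose q"
        using q(2) by (rule Suc.IH)
      ultimately show ?thesis
        unfolding 0 q(1) by (cases q) simp_all
    next
      case h: (Suc h')
      then have n: "n = h' + 2 * p" using Suc.prems by simp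
      then have IH: "dyck_paths n h' + (if p = 0 then 0 else n choose (p - 1)) = n choose p"
        by (rule Suc.IH)
      show ?thesis
      proof (cases p)
        case 0
        then show ?thesis
          using IH n h dyck_paths_eq_0[of n "Suc h"] by simp
      next
        case p: (Suc q)
        then have "n = Suc h + 2 * q" using n h by simp
        then have "dyck_paths n (Suc h) + (if q = 0 then 0 else n choose (q - 1)) = n choose q"
          by (rule Suc.IH)
        then show ?thesis
          using IH unfolding h p by (cases q) simp_all
      qed
    qed
  qed auto
  then show ?thesis by blast
qed

lemma dyck_paths_eq_catalan:
  "real (dyck_paths (2 * n) 0) = 1 / (real n + 1) * real ((2 * n) choose n)"
proof (cases n)
  case (Suc p)
  define c where "c = (2 * n) choose n"
  define c' where "c' = (2 * n) choose p"
  have "Suc (p + Suc p) = 2 * n" using Suc by simp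
  then have "Suc p * c = Suc (Suc p) * c'"
    using Suc_times_binomial_add[of p "Suc p"] Suc by (simp only: c_def c'_def)
  then have "real (Suc p * c) = real (Suc (Suc p) * c')" by (simp only:)
  then have ratio: "real n * real c = (real n + 1) * real c'"
    unfolding of_nat_mult using Suc by simp
  have "dyck_paths (2 * n) 0 + c' = c"
    using dyck_paths_eq_choose_diff[of 0 n] Suc unfolding c_def c'_def by (simp del: mult_Suc_right)
  then have "real (dyck_paths (2 * n) 0) = real c - real c'" by linarith
  then have "(real n + 1) * real (dyck_paths (2 * n) 0) = real c"
    using ratio by (simp only: right_diff_distrib ratio[symmetric]) (simp add: algebra_simps)
  then show ?thesis unfolding c_def[symmetric] by (simp add: field_simps)
qed simp

section \<open>Words with few indices\<close>

text \<open>Such a word is determined by a list of \<open>d\<close> indices, padded if fewer occur, and by the position in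
  this list and the sign of each letter.\<close>

lemma card_few_indices_le:
  fixes J :: "'x set"
  assumes "finite J" "J \<noteq> {}"
  shows "card {w \<in> words J. length w = k \<and> card (fst ` set w) \<le> d} \<le>
    card J ^ d * (2 * d) ^ k"
proof -
  let ?A = "{xs. set xs \<subseteq> J \<and> length xs = d}"
  let ?B = "{v. set v \<subseteq> {..<d} \<times> (UNIV :: bool set) \<and> length v = k}"
  let ?g = "\<lambda>(xs, v). map (\<lambda>(i, b). (xs ! i, b)) v"
  obtain z where z: "z \<in> J" using assms(2) by blast
  have "{w \<in> words J. length w = k \<and> card (fst ` set w) \<le> d} \<subseteq> ?g ` (?A \<times> ?B)"
  proof
    fix w assume "w \<in> {w \<in> words J. length w = k \<and> card (fst ` set w) \<le> d}"
    then have w: "fst ` set w \<subseteq> J" "length w = k" "card (fst ` set w) \<le> d"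
      by (auto simp: words_def)
    obtain ys where ys: "set ys = fst ` set w" "distinct ys"
      using finite_distinct_list[of "fst ` set w"] by auto
    define xs where "xs = ys @ replicate (d - length ys) z"
    have len: "length ys \<le> d" using w(3) distinct_card[OF ys(2)] ys(1) by simp
    have xs: "xs \<in> ?A" using w(1) ys(1) z len by (auto simp: xs_def)
    have "\<exists>i. i < d \<and> xs ! i = j" if "j \<in> fst ` set w" for j
    proof -
      have "j \<in> set ys" using that unfolding ys(1) .
      then obtain i where "i < length ys" "ys ! i = j"
        by (auto simp: in_set_conv_nth)
      then show ?thesis using len by (intro exI[of _ i]) (auto simp: xs_def nth_append)
    qed
    then obtain f where f: "\<And>j. j \<in> fst ` set w \<Longrightarrow> f j < d \<and> xs ! f j = j"
      using bchoice[of "fst ` set w" "\<lambda>j i. i < d \<and> xs ! i = j"] by blast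
    define v where "v = map (\<lambda>(j, b). (f j, b)) w"
    have idx: "f j < d" "xs ! f j = j" if "(j, b) \<in> set w" for j b
      using f[of j] image_eqI[of j fst "(j, b)" "set w"] that by simp_all
    have "v \<in> ?B"
      using idx(1) w(2) by (auto simp: v_def)
    moreover have "?g (xs, v) = w"
    proof -
      have "map (\<lambda>(j, b). (xs ! f j, b)) w = w"
        using idx(2) by (intro map_idI) auto
      then show ?thesis by (simp add: v_def comp_def split_def)
    qed
    ultimately show "w \<in> ?g ` (?A \<times> ?B)" using xs image_eqI[of w ?g "(xs, v)" "?A \<times> ?B"] by simp
  qed
  moreover have "finite ?A" "finite ?B"
    using assms(1) by (auto intro: finite_lists_length_eq)
  ultimately have "card {w \<in> words J. length w = k \<and> card (fst ` set w) \<le> d} \<le> card (?A \<times> ?B)"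
    by (intro surj_card_le) auto
  also have "\<dots> = card J ^ d * (2 * d) ^ k"
    using card_lists_length_eq[of J d] assms(1)
      card_lists_length_eq[of "{..<d} \<times> (UNIV :: bool set)" k]
    by (simp add: card_cartesian_product mult.commute)
  finally show ?thesis .
qed

text \<open>The freely trivial words give the limit; by \<open>trivial_imp_few_indices\<close> the other trivial words
  number at most a constant times \<open>N\<^sup>d\<close> with \<open>2 d < k\<close>, which is of smaller order than
  \<open>(2 N)\<^sup>k\<^sup>/\<^sup>2\<close>.\<close>

lemma trivial_words_asymptotics:
  fixes s :: "nat \<Rightarrow> 's"
  assumes s: "inj_on s {1..}" "s ` {1..} \<subseteq> S"
    and cox: "coxeter_matrix S m"
    and m: "\<And>x y. x \<in> S \<Longrightarrow> y \<in> S \<Longrightarrow> x \<noteq> y \<Longrightarrow> m x y \<ge> 4"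
  shows "(\<lambda>N. real (card {w \<in> words (s ` {1..N}).
        length w = k \<and> pres_eq S (artin_relations S m) w []}) / sqrt (2 * real N) ^ k)
      \<longlonglongrightarrow> real (dyck_paths k 0)"
proof -
  define J where "J N = s ` {1..N}" for N
  define T where "T N = {w \<in> words (J N). length w = k \<and> pres_eq S (artin_relations S m) w []}" for N
  define F where "F N = {w \<in> words (J N). length w = k \<and> free_reduction w = []}" for N
  \<comment> \<open>For \<open>k > 0\<close> this is the largest number of indices allowed by \<open>trivial_imp_few_indices\<close>.\<close>
  define d where "d = (k - 1) div 2"
  define c where "c = real ((2 * d) ^ k)"
  have card_J: "card (J N) = N" for N
    using card_image[OF inj_on_subset[OF s(1), of "{1..N}"]] by (auto simp: J_def)
  have J: "J N \<subseteq> S" "finite (J N)" for N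
    using s(2) by (auto simp: J_def)
  have words: "words (J N) = {w. set w \<subseteq> J N \<times> UNIV}" for N
    by (auto simp: words_def)
  have fin: "finite (T N)" "finite (F N)" for N
    by (rule finite_subset[OF _ finite_lists_length_eq[of "J N \<times> UNIV" k]];
        use J in \<open>auto simp: T_def F_def words\<close>)+
  have card_F: "card (F N) = tree_walks (2 * N) k 0" for N
  proof -
    have "F N = {w. set w \<subseteq> J N \<times> UNIV \<and> length w = k \<and> fold push w [] = []}"
      by (auto simp: F_def words free_reduction_def)
    moreover have "card (J N \<times> (UNIV :: bool set)) = 2 * N"
      by (simp add: card_cartesian_product card_J)
    moreover have "flip ` (J N \<times> UNIV) \<subseteq> J N \<times> UNIV"
      by (auto simp: flip_def)
    ultimately show ?thesis
      using card_fold_push_eq_tree_walks[of "J N \<times> UNIV" "[]" k] J(2)[of N]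
      by (simp add: mult.commute)
  qed
  have sub: "F N \<subseteq> T N" for N
  proof
    fix w assume "w \<in> F N"
    moreover from this have "w \<in> words S" using words_mono[OF J(1)[of N]] by (auto simp: F_def)
    ultimately show "w \<in> T N"
      using pres_eq_free_reduction[of w S "artin_relations S m"] by (simp add: T_def F_def)
  qed
  have diff: "card (T N) - card (F N) \<le> N ^ d * (2 * d) ^ k \<and> (card (T N) \<noteq> card (F N) \<longrightarrow> 2 * d < k)"
    if N: "N > 0" for N
  proof -
    have "2 * card (fst ` set w) < k" if "w \<in> T N - F N" for w
      using trivial_imp_few_indices[of S m w, OF cox m] that by (simp add: T_def F_def)
    then have few: "T N - F N \<subseteq> {w \<in> words (J N). length w = k \<and> card (fst ` set w) \<le> d}"
      and "T N - F N \<noteq> {} \<Longrightarrow> 2 * d < k"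
      unfolding d_def by (force simp: T_def)+
    moreover have "J N \<noteq> {}" using N by (auto simp: J_def)
    moreover have "finite {w \<in> words (J N). length w = k \<and> card (fst ` set w) \<le> d}"
      by (rule finite_subset[OF _ finite_lists_length_eq[of "J N \<times> UNIV" k]])
        (use J in \<open>auto simp: words\<close>)
    ultimately have "card (T N - F N) \<le> N ^ d * (2 * d) ^ k"
      using card_few_indices_le[of "J N" k d] J(2) card_J
      by (metis (no_types, lifting) card_mono order_trans)
    moreover have "card (T N - F N) = card (T N) - card (F N)"
      using sub fin by (intro card_Diff_subset) auto
    moreover have "T N = F N" if "T N - F N = {}" using that sub by blast
    ultimately show ?thesis
      using \<open>T N - F N \<noteq> {} \<Longrightarrow> 2 * d < k\<close> by metis
  qed
  have bound: "norm (real (card (T N)) / sqrt (2 * real N) ^ k - real (card (F N)) / sqrt (2 * real N) ^ k)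
      \<le> norm (1 / sqrt (real N)) * c" if N: "N > 0" for N
  proof (cases "card (T N) = card (F N)")
    case True
    then show ?thesis by (simp add: c_def)
  next
    case False
    then have d: "2 * d < k" using diff[OF N] by blast
    define x where "x = sqrt (real N)"
    define y where "y = sqrt (2 * real N)"
    have x: "x \<ge> 1" "real N = x\<^sup>2" "x \<le> y" using N by (simp_all add: x_def y_def)
    have le: "card (F N) \<le> card (T N)" using sub fin by (simp add: card_mono)
    have "x ^ (2 * d) * x \<le> x ^ k"
      using power_increasing[of "Suc (2 * d)" k x] d x by (simp add: mult.commute)
    also have "\<dots> \<le> y ^ k" using x by (intro power_mono) auto
    finally have xy: "x ^ (2 * d) / y ^ k \<le> 1 / x"
      using x by (simp add: field_simps)
    have "real (card (T N)) - real (card (F N)) \<le> real (N ^ d * (2 * d) ^ k)"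
      using diff[OF N] le by (simp only: of_nat_diff[OF le, symmetric] of_nat_le_iff)
    also have "\<dots> = c * x ^ (2 * d)"
      by (simp add: c_def x(2) power_mult)
    finally have "(real (card (T N)) - real (card (F N))) / y ^ k \<le> c * (x ^ (2 * d) / y ^ k)"
      using x by (simp add: divide_right_mono)
    also have "\<dots> \<le> c * (1 / x)"
      using xy by (intro mult_left_mono) (auto simp: c_def)
    finally show ?thesis
      unfolding x_def[symmetric] y_def[symmetric] diff_divide_distrib[symmetric]
      using le x(1,3) by (simp add: mult.commute)
  qed
  have "filterlim (\<lambda>N::nat. 2 * N) sequentially sequentially"
    by (rule filterlim_subseq) (simp add: strict_mono_def)
  from filterlim_compose[OF tree_walks_asymptotics[of k 0] this]
  have F: "(\<lambda>N. real (card (F N)) / sqrt (2 * real N) ^ k) \<longlonglongrightarrow> real (dyck_paths k 0)"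
    by (simp add: card_F)
  have "(\<lambda>N. 1 / sqrt (real N)) \<longlonglongrightarrow> 0"
    by (intro tendsto_divide_0[OF tendsto_const] filterlim_at_top_imp_at_infinity
        filterlim_compose[OF sqrt_at_top] filterlim_real_sequentially)
  moreover have "eventually (\<lambda>N.
      norm (real (card (T N)) / sqrt (2 * real N) ^ k - real (card (F N)) / sqrt (2 * real N) ^ k)
        \<le> norm (1 / sqrt (real N)) * c) sequentially"
    using eventually_gt_at_top[of "0::nat"]
    by eventually_elim (rule bound)
  ultimately have "(\<lambda>N. real (card (T N)) / sqrt (2 * real N) ^ k -
      real (card (F N)) / sqrt (2 * real N) ^ k) \<longlonglongrightarrow> 0"
    by (rule tendsto_0_le)
  from tendsto_add[OF this F] show ?thesis
    by (simp add: T_def J_def)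
qed

section \<open>Powers in the group algebra\<close>

lemma finsum_group_algebra:
  assumes "group G" "finite I" "\<And>i. i \<in> I \<Longrightarrow> f i \<in> carrier (group_algebra G)"
  shows "(\<Oplus>\<^bsub>group_algebra G\<^esub> i \<in> I. f i) = (\<Sum>i\<in>I. f i)"
proof -
  interpret ring "group_algebra G" using assms(1) by (rule ring_group_algebra)
  show ?thesis
    using assms(2,3)
  proof (induction I rule: finite_induct)
    case (insert i I)
    have "finsum (group_algebra G) f (insert i I) =
        f i \<oplus>\<^bsub>group_algebra G\<^esub> finsum (group_algebra G) f I"
      using insert.hyps insert.prems by (intro finsum_insert) blast+
    then show ?case using insert by simp
  qed simp
qed

lemma group_algebra_sum_mult:
  "(\<Sum>i\<in>I. f i) \<otimes>\<^bsub>group_algebra G\<^esub> g = (\<Sum>i\<in>I. f i \<otimes>\<^bsub>group_algebra G\<^esub> g)"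
  by (induction I rule: infinite_finite_induct) (simp_all add: group_algebra_add_mult)

lemma group_algebra_mult_sum:
  "g \<otimes>\<^bsub>group_algebra G\<^esub> (\<Sum>i\<in>I. f i) = (\<Sum>i\<in>I. g \<otimes>\<^bsub>group_algebra G\<^esub> f i)"
  by (induction I rule: infinite_finite_induct) (simp_all add: group_algebra_mult_add)

lemma group_algebra_power_sum_single:
  assumes G: "group G" and L: "finite L" "\<And>x. x \<in> L \<Longrightarrow> g x \<in> carrier G"
  shows "(\<Sum>x\<in>L. Poly_Mapping.single (g x) c) [^]\<^bsub>group_algebra G\<^esub> k =
    (\<Sum>w | set w \<subseteq> L \<and> length w = k.
      Poly_Mapping.single (foldr (\<lambda>x. (\<otimes>\<^bsub>G\<^esub>) (g x)) w \<one>\<^bsub>G\<^esub>) (c ^ k))"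
proof -
  interpret ring "group_algebra G" using G by (rule ring_group_algebra)
  let ?X = "\<Sum>x\<in>L. Poly_Mapping.single (g x) c"
  let ?W = "\<lambda>k. {w. set w \<subseteq> L \<and> length w = k}"
  let ?p = "\<lambda>w. foldr (\<lambda>x. (\<otimes>\<^bsub>G\<^esub>) (g x)) w \<one>\<^bsub>G\<^esub>"
  have X: "?X \<in> carrier (group_algebra G)"
  proof -
    have "Poly_Mapping.keys ?X \<subseteq> (\<Union>x\<in>L. Poly_Mapping.keys (Poly_Mapping.single (g x) c))"
      by (rule keys_sum)
    also have "\<dots> \<subseteq> carrier G" using L(2) by auto
    finally show ?thesis by simp
  qed
  show ?thesis
  proof (induction k)
    case 0
    have "?W 0 = {[]}" by auto
    then show ?case by (simp add: delta_def)
  next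
    case (Suc k)
    have "?X [^]\<^bsub>group_algebra G\<^esub> Suc k = ?X \<otimes>\<^bsub>group_algebra G\<^esub> (?X [^]\<^bsub>group_algebra G\<^esub> k)"
      using X by (rule nat_pow_Suc2)
    also have "\<dots> = (\<Sum>x\<in>L. \<Sum>w\<in>?W k. Poly_Mapping.single (?p (x # w)) (c ^ Suc k))"
      unfolding Suc
      by (simp add: group_algebra_sum_mult group_algebra_mult_sum single_mult_single_group_algebra)
        (rule sum.swap)
    also have "\<dots> = (\<Sum>w\<in>(\<lambda>(x, w). x # w) ` (L \<times> ?W k). Poly_Mapping.single (?p w) (c ^ Suc k))"
      by (subst sum.reindex) (auto simp: inj_on_def sum.cartesian_product split_def)
    also have "(\<lambda>(x, w). x # w) ` (L \<times> ?W k) = ?W (Suc k)"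
      by (force simp: length_Suc_conv)
    finally show ?case .
  qed
qed

lemma canonical_trace_power_sum_single:
  assumes "group G" "finite L" "\<And>x. x \<in> L \<Longrightarrow> g x \<in> carrier G"
  shows "canonical_trace G ((\<Sum>x\<in>L. Poly_Mapping.single (g x) c) [^]\<^bsub>group_algebra G\<^esub> k) =
    c ^ k * of_nat (card {w. set w \<subseteq> L \<and> length w = k \<and>
      foldr (\<lambda>x. (\<otimes>\<^bsub>G\<^esub>) (g x)) w \<one>\<^bsub>G\<^esub> = \<one>\<^bsub>G\<^esub>})"
proof -
  let ?W = "{w. set w \<subseteq> L \<and> length w = k}"
  let ?p = "\<lambda>w. foldr (\<lambda>x. (\<otimes>\<^bsub>G\<^esub>) (g x)) w \<one>\<^bsub>G\<^esub>"
  have fin: "finite ?W" using assms(2) by (rule finite_lists_length_eq)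
  have "canonical_trace G ((\<Sum>x\<in>L. Poly_Mapping.single (g x) c) [^]\<^bsub>group_algebra G\<^esub> k) =
      (\<Sum>w\<in>?W. if ?p w = \<one>\<^bsub>G\<^esub> then c ^ k else 0)"
    using group_algebra_power_sum_single[OF assms]
    by (simp add: canonical_trace_def lookup_sum lookup_single when_def)
  also have "\<dots> = (\<Sum>w\<in>{w\<in>?W. ?p w = \<one>\<^bsub>G\<^esub>}. c ^ k)"
    by (rule sum.inter_filter[OF fin, symmetric])
  also have "{w\<in>?W. ?p w = \<one>\<^bsub>G\<^esub>} = {w. set w \<subseteq> L \<and> length w = k \<and> ?p w = \<one>\<^bsub>G\<^esub>}"
    by auto
  finally show ?thesis by (simp add: mult.commute)
qed

lemma foldr_mult_pres_class:
  assumes "w \<in> words X"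
  shows "foldr (\<lambda>x. (\<otimes>\<^bsub>presented_group X R\<^esub>) (pres_class X R [x])) w \<one>\<^bsub>presented_group X R\<^esub> =
    pres_class X R w"
  using assms
proof (induction w)
  case Nil
  then show ?case by (simp add: presented_group_def)
next
  case (Cons x w)
  then show ?case by (simp add: mult_presented_group)
qed

lemma inv_artin_generator:
  assumes "x \<in> S"
  shows "inv\<^bsub>artin_group S m\<^esub> (artin_generator S m x) = pres_class S (artin_relations S m) [(x, False)]"
proof -
  interpret group "artin_group S m" by (rule group_artin_group)
  have "pres_eq S (artin_relations S m) ([] @ [(x, False), (x, \<not> False)] @ []) ([] @ [])"
    using assms by (intro pres_eq.cancel) auto
  then have "pres_class S (artin_relations S m) [(x, False)] \<otimes>\<^bsub>artin_group S m\<^esub> artin_generator S m x =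
      \<one>\<^bsub>artin_group S m\<^esub>"
    using assms mult_presented_group[of "[(x, False)]" S "[(x, True)]" "artin_relations S m"]
    by (simp add: artin_group_def artin_generator_def pres_class_eq_iff)
       (simp add: presented_group_def pres_class_eq_iff)
  then show ?thesis
    using assms artin_generator_in_carrier[OF assms, of m]
    by (intro inv_equality) (auto simp: artin_group_def presented_group_def)
qed

theorem theorem3:
  fixes S :: "'s set" and s :: "nat \<Rightarrow> 's" and m :: "'s \<Rightarrow> 's \<Rightarrow> enat" and k :: nat
  defines "A \<equiv> artin_group S m"
    and "a \<equiv> \<lambda>i. artin_generator S m (s i)"
  assumes "bij_betw s {1..} S"
    and "coxeter_matrix S m"
    and "\<And>x y. x \<in> S \<Longrightarrow> y \<in> S \<Longrightarrow> x \<noteq> y \<Longrightarrow> m x y \<ge> 4"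
  shows "(\<lambda>N. canonical_trace A
      ((complex_of_real (1 / sqrt (2 * real N)) \<odot>\<^bsub>group_algebra A\<^esub>
        (\<Oplus>\<^bsub>group_algebra A\<^esub> i \<in> {1..N}.
          delta (a i) \<oplus>\<^bsub>group_algebra A\<^esub> delta (inv\<^bsub>A\<^esub> (a i)))) [^]\<^bsub>group_algebra A\<^esub> k))
    \<longlonglongrightarrow> (if odd k then 0
         else let n = k div 2 in complex_of_real (1 / (real n + 1) * real ((2 * n) choose n)))"
proof -
  let ?R = "artin_relations S m"
  let ?g = "\<lambda>x. pres_class S ?R [x]"
  have s: "inj_on s {1..}" "s ` {1..} \<subseteq> S"
    using assms(3) by (auto simp: bij_betw_def)
  have A: "group A" unfolding A_def by (rule group_artin_group)
  have g: "?g x \<in> carrier A" if "fst x \<in> S" for x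
    using that by (auto simp: A_def artin_group_def presented_group_def)
  have moment: "canonical_trace A
      ((complex_of_real (1 / sqrt (2 * real N)) \<odot>\<^bsub>group_algebra A\<^esub>
        (\<Oplus>\<^bsub>group_algebra A\<^esub> i \<in> {1..N}.
          delta (a i) \<oplus>\<^bsub>group_algebra A\<^esub> delta (inv\<^bsub>A\<^esub> (a i)))) [^]\<^bsub>group_algebra A\<^esub> k) =
      complex_of_real (real (card {w \<in> words (s ` {1..N}). length w = k \<and> pres_eq S ?R w []})
        / sqrt (2 * real N) ^ k)" for N
  proof -
    define c where "c = complex_of_real (1 / sqrt (2 * real N))"
    define L where "L = s ` {1..N} \<times> (UNIV :: bool set)"
    have S: "s i \<in> S" if "i \<in> {1..N}" for i
      using s(2) that by auto
    then have L: "finite L" "fst x \<in> S" if "x \<in> L" for x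
      using that by (auto simp: L_def)
    have a: "a i = ?g (s i, True)" "inv\<^bsub>A\<^esub> (a i) = ?g (s i, False)" if "i \<in> {1..N}" for i
      using inv_artin_generator[OF S[OF that], of m] by (simp_all add: a_def A_def artin_generator_def)
    have "(\<Oplus>\<^bsub>group_algebra A\<^esub> i \<in> {1..N}. delta (a i) \<oplus>\<^bsub>group_algebra A\<^esub> delta (inv\<^bsub>A\<^esub> (a i))) =
        (\<Sum>i\<in>{1..N}. delta (a i) + delta (inv\<^bsub>A\<^esub> (a i)))"
    proof (subst finsum_group_algebra[OF A])
      fix i assume i: "i \<in> {1..N}"
      have "a i \<in> carrier A" "inv\<^bsub>A\<^esub> (a i) \<in> carrier A"
        using a[OF i] g S[OF i] by auto
      then show "delta (a i) \<oplus>\<^bsub>group_algebra A\<^esub> delta (inv\<^bsub>A\<^esub> (a i)) \<in> carrier (group_algebra A)"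
        using keys_add[of "delta (a i)" "delta (inv\<^bsub>A\<^esub> (a i))"] by (auto simp: delta_def)
    qed simp_all
    also have "\<dots> = (\<Sum>i\<in>{1..N}. \<Sum>b\<in>UNIV. delta (?g (s i, b)))"
      using a by (intro sum.cong HOL.refl) (simp add: UNIV_bool add.commute)
    also have "\<dots> = (\<Sum>i\<in>s ` {1..N}. \<Sum>b\<in>UNIV. delta (?g (i, b)))"
      using inj_on_subset[OF s(1), of "{1..N}"] by (subst sum.reindex) auto
    also have "\<dots> = (\<Sum>x\<in>L. delta (?g x))"
      by (simp add: L_def sum.cartesian_product split_def)
    finally have "c \<odot>\<^bsub>group_algebra A\<^esub> (\<Oplus>\<^bsub>group_algebra A\<^esub> i \<in> {1..N}.
        delta (a i) \<oplus>\<^bsub>group_algebra A\<^esub> delta (inv\<^bsub>A\<^esub> (a i))) = (\<Sum>x\<in>L. Poly_Mapping.single (?g x) c)"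
      by (intro poly_mapping_eqI)
        (simp add: lookup_smult_group_algebra lookup_sum delta_def lookup_single when_def
          sum_distrib_left, intro sum.cong, auto)
    moreover have "{w. set w \<subseteq> L \<and> length w = k \<and>
        foldr (\<lambda>x. (\<otimes>\<^bsub>A\<^esub>) (?g x)) w \<one>\<^bsub>A\<^esub> = \<one>\<^bsub>A\<^esub>} =
        {w \<in> words (s ` {1..N}). length w = k \<and> pres_eq S ?R w []}"
    proof -
      have "foldr (\<lambda>x. (\<otimes>\<^bsub>A\<^esub>) (?g x)) w \<one>\<^bsub>A\<^esub> = \<one>\<^bsub>A\<^esub> \<longleftrightarrow> pres_eq S ?R w []"
        if "w \<in> words (s ` {1..N})" for w
      proof -
        have w: "w \<in> words S" using that words_mono[of "s ` {1..N}" S] S by blast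
        have "\<one>\<^bsub>A\<^esub> = pres_class S ?R []"
          by (simp add: A_def artin_group_def presented_group_def)
        then show ?thesis
          using foldr_mult_pres_class[OF w, of ?R] pres_class_eq_iff[OF w, of ?R "[]"]
          by (simp add: A_def artin_group_def)
      qed
      moreover have "set w \<subseteq> L \<longleftrightarrow> w \<in> words (s ` {1..N})" for w
        by (auto simp: L_def words_def)
      ultimately show ?thesis by blast
    qed
    ultimately show ?thesis
      using canonical_trace_power_sum_single[OF A, of L ?g c k] L g
      by (simp add: c_def[symmetric]) (simp add: c_def L_def power_divide)
  qed
  have "(\<lambda>N. complex_of_real
      (real (card {w \<in> words (s ` {1..N}). length w = k \<and> pres_eq S ?R w []})
        / sqrt (2 * real N) ^ k)) \<longlonglongrightarrow> complex_of_real (real (dyck_paths k 0))"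
    by (intro tendsto_of_real trivial_words_asymptotics s assms(4,5))
  moreover have "complex_of_real (real (dyck_paths k 0)) = (if odd k then 0
      else let n = k div 2 in complex_of_real (1 / (real n + 1) * real ((2 * n) choose n)))"
  proof (cases "odd k")
    case True
    then show ?thesis using dyck_paths_eq_0[of k 0] by simp
  next
    case False
    then have "2 * (k div 2) = k" by simp
    then show ?thesis using dyck_paths_eq_catalan[of "k div 2"] False by (simp only: Let_def if_False)
  qed
  ultimately show ?thesis by (simp only: moment)
qed

end
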